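(* Let $\pi\in\Pi_M(\mu,\nu)$ be a martingale transport plan. Then $\pi$ is the left-monotone coupling of $\Pi_M(\mu,\nu)$ if and only if the following condition holds: for every $(x,y^+),(x,y^-),(x',y')\in\mathrm{spt}^*(\pi)$ with $x<x'$ and $y^-<y^+$, one has $y'\notin\,]y^-,y^+[$.
   Context: $\mu,\nu$ are Borel probability measures on $\mathbb R$ with finite first moment. $\Pi_M(\mu,\nu)$ is the set of $\pi=\mathrm{Law}(X,Y)$ on $\mathbb R^2$ with marginals $\mu$ and $\nu$ and $\mathbb E(Y|X)=X$. $(\pi_x)_x$ denotes the disintegration of $\pi$ with respect to its first marginal $\mu$ (probability measures $\pi_x$ with $\pi=\int\delta_x\otimes\pi_x\,d\mu(x)$), and $\mathrm{spt}$ the topological support. Left-monotone: $\pi\in\Pi_M(\mu,\nu)$ is left-monotone if there is a Borel set $\Gamma\subset\mathbb R^2$ with $\pi(\Gamma)=1$ such that for every $(x,y^-),(x,y^+),(x',y')\in\Gamma$ with $x<x'$ and $y^-<y^+$ one has $y'\notin]y^-,y^+[$. (It is known that when $\Pi_M(\mu,\nu)\neq\emptyset$ it contains exactly one left-monotone element.) Reduced support: let $A=\{x\in\mathbb R:\pi(]-\infty,x[\times]x,+\infty[)=0\}$ and let $A^-\subset A$ be the set of points of $A$ that are isolated in $A$ on the right (i.e. $x\in A$ with $]x,x+\varepsilon[\cap A=\emptyset$ for some $\varepsilon>0$). Then $$\mathrm{spt}^*(\pi)=\big(\mathrm{spt}(\pi)\setminus(A^-\times\mathbb R)\big)\cup\bigcup_{x:\,\mu(\{x\})>0}\{x\}\times\mathrm{spt}(\pi_x).$$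 *)

theory Defs
  imports "HOL-Probability.Probability"
begin

text \<open>The law of \<open>(X, Y)\<close> is realised on the canonical space: \<open>X = fst\<close>, \<open>Y = snd\<close>, and
  conditioning on \<open>X\<close> is conditioning on the \<open>\<sigma>\<close>-algebra generated by \<open>fst\<close>.\<close>

definition martingale_couplings :: "real measure \<Rightarrow> real measure \<Rightarrow> (real \<times> real) measure set"
  where "martingale_couplings \<mu> \<nu> =
    {\<pi>. sets \<pi> = sets borel \<and> prob_space \<pi> \<and>
        distr \<pi> borel fst = \<mu> \<and> distr \<pi> borel snd = \<nu> \<and>
        (AE z in \<pi>. real_cond_exp \<pi> (vimage_algebra (space \<pi>) fst borel) snd z = fst z)}"

definition left_monotone_on :: "(real \<times> real) set \<Rightarrow> bool"
  where "left_monotone_on \<Gamma> \<longleftrightarrow>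
    (\<forall>x ym yp x' y'. (x, ym) \<in> \<Gamma> \<and> (x, yp) \<in> \<Gamma> \<and> (x', y') \<in> \<Gamma> \<and> x < x' \<and> ym < yp
       \<longrightarrow> y' \<notin> {ym<..<yp})"

definition left_monotone :: "(real \<times> real) measure \<Rightarrow> bool"
  where "left_monotone \<pi> \<longleftrightarrow>
    (\<exists>\<Gamma>. \<Gamma> \<in> sets borel \<and> emeasure \<pi> \<Gamma> = 1 \<and> left_monotone_on \<Gamma>)"

definition disintegration :: "(real \<times> real) measure \<Rightarrow> (real \<Rightarrow> real measure) \<Rightarrow> bool"
  where "disintegration \<pi> \<kappa> \<longleftrightarrow>
    \<kappa> \<in> borel \<rightarrow>\<^sub>M prob_algebra borel \<and>
    \<pi> = distr \<pi> borel fst \<bind> (\<lambda>x. return borel x \<Otimes>\<^sub>M \<kappa> x)"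

definition spt :: "'a::topological_space measure \<Rightarrow> 'a set"
  where "spt M = {x. \<forall>U. open U \<and> x \<in> U \<longrightarrow> 0 < emeasure M U}"

definition no_crossing :: "(real \<times> real) measure \<Rightarrow> real set"
  where "no_crossing \<pi> = {x. emeasure \<pi> ({..<x} \<times> {x<..}) = 0}"

definition right_isolated :: "real set \<Rightarrow> real set"
  where "right_isolated A = {x \<in> A. \<exists>\<epsilon>>0. {x<..<x + \<epsilon>} \<inter> A = {}}"

text \<open>Although \<open>\<kappa>\<close> is determined only almost everywhere, the reduced support does not depend on
  the choice of the disintegration: \<open>\<kappa> x\<close> enters only at the atoms \<open>x\<close> of the first marginal.\<close>

definition reduced_spt :: "(real \<times> real) measure \<Rightarrow> (real \<Rightarrow> real measure) \<Rightarrow> (real \<times> real) set"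
  where "reduced_spt \<pi> \<kappa> =
    (spt \<pi> - right_isolated (no_crossing \<pi>) \<times> UNIV) \<union>
    (\<Union>x\<in>{x. 0 < emeasure (distr \<pi> borel fst) {x}}. {x} \<times> spt (\<kappa> x))"

end

theory Submission
  imports Defs
begin

text \<open>
  If the condition holds on the reduced support, the reduced support itself witnesses left
  monotonicity: it is Borel (\<open>sets_reduced_spt\<close>) and has full measure
  (\<open>emeasure_reduced_spt\<close>), because \<open>right_isolated (no_crossing \<pi>)\<close> is countable, so the
  vertical lines removed from \<open>spt \<pi>\<close> matter only at atoms of the first marginal, and there the
  supports of the kernel are put back.

  Conversely, let \<open>\<Gamma>\<close> be a left-monotone set of full measure, and suppose that the reduced support
  contains a forbidden triple: points at heights \<open>ym < y' < yp\<close>, the extreme two above \<open>x\<close>, the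
  middle one above some \<open>x' > x\<close>. The reduced support lies inside the topological support, so each
  of the three points is a limit of points of \<open>\<Gamma>\<close>. The difficulty is that the approximations of
  \<open>(x, ym)\<close> and \<open>(x, yp)\<close> have different abscissae, while left monotonicity speaks only of pairs
  of points on one vertical line. The martingale property supplies the missing partner: for almost
  every \<open>a\<close> the mean of \<open>\<kappa> a\<close> is \<open>a\<close>, so if \<open>\<kappa> a\<close> charges one side of \<open>a\<close> it charges the other side too, and
  \<open>\<Gamma>\<close> can be met on both (\<open>martingale_opposite_point\<close>).

  Choose \<open>(e, f)\<close> in \<open>\<Gamma>\<close> near \<open>(x', y')\<close>, with \<open>x < e\<close> and \<open>ym < f < yp\<close>. If \<open>f < x\<close>, a point
  of \<open>\<Gamma>\<close> near \<open>(x, ym)\<close> and its partner enclose \<open>f\<close>; if \<open>f > x\<close>, a point near \<open>(x, yp)\<close> and its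
  partner do. Both contradict left monotonicity. If \<open>f = x\<close>, the partners need not
  enclose \<open>f\<close>, since the approximating abscissae may lie on the wrong side of \<open>x\<close>; this is the
  case for which the reduced support is designed. Any mass crossing from the left of \<open>x\<close> to its right would,
  with its partner, enclose \<open>x\<close>, so \<open>x\<close> belongs to \<open>no_crossing \<pi>\<close>. The mass near \<open>(x, yp)\<close>
  crosses every \<open>t\<close> between \<open>x\<close> and \<open>yp\<close>, so \<open>x\<close> is isolated there on the right. Hence \<open>x\<close> is an
  atom and \<open>ym\<close> lies in the support of \<open>\<kappa> x\<close>: now approximating points can be found exactly above
  \<open>x\<close>, and a point below \<open>x\<close> with its partner above \<open>x\<close> encloses \<open>f = x\<close>.
\<close>

section \<open>Disintegration along the first coordinate\<close>

lemma emeasure_disintegration: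
  assumes "disintegration \<pi> \<kappa>" and "S \<in> sets borel"
  shows "emeasure \<pi> S = (\<integral>\<^sup>+x. emeasure (\<kappa> x) {y. (x, y) \<in> S} \<partial>distr \<pi> borel fst)"
proof -
  let ?\<mu> = "distr \<pi> borel fst :: real measure"
  have \<kappa>: "\<kappa> \<in> borel \<rightarrow>\<^sub>M subprob_algebra borel"
    using assms(1) measurable_prob_algebraD unfolding disintegration_def by blast
  have \<kappa>\<mu>: "\<kappa> \<in> ?\<mu> \<rightarrow>\<^sub>M subprob_algebra borel"
    using \<kappa> by (simp cong: measurable_cong_sets)
  have pi: "\<pi> = ?\<mu> \<bind> (\<lambda>x. return borel x \<Otimes>\<^sub>M \<kappa> x)"
    using assms(1) unfolding disintegration_def by blast
  have S: "S \<in> sets (borel \<Otimes>\<^sub>M borel)"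
    using assms(2) by (simp only: borel_prod)
  have ret: "return borel \<in> ?\<mu> \<rightarrow>\<^sub>M subprob_algebra (borel :: real measure)"
    by (simp cong: measurable_cong_sets)
  have kernel: "(\<lambda>x. return borel x \<Otimes>\<^sub>M \<kappa> x) \<in> ?\<mu> \<rightarrow>\<^sub>M subprob_algebra (borel \<Otimes>\<^sub>M borel)"
    by (rule measurable_pair_measure[OF ret \<kappa>\<mu>])
  have "emeasure \<pi> S = emeasure (?\<mu> \<bind> (\<lambda>x. return borel x \<Otimes>\<^sub>M \<kappa> x)) S"
    using pi by simp
  also have "\<dots> = (\<integral>\<^sup>+x. emeasure (return borel x \<Otimes>\<^sub>M \<kappa> x) S \<partial>?\<mu>)"
    by (rule emeasure_bind[OF _ kernel S]) simp
  also have "\<dots> = (\<integral>\<^sup>+x. emeasure (\<kappa> x) {y. (x, y) \<in> S} \<partial>?\<mu>)"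
  proof (rule nn_integral_cong)
    fix x :: real
    have sk: "sets (\<kappa> x) = sets borel" and "subprob_space (\<kappa> x)"
      using measurable_space[OF \<kappa>, of x] by (auto simp: space_subprob_algebra)
    interpret K: subprob_space "\<kappa> x" by fact
    have S': "S \<in> sets (return borel x \<Otimes>\<^sub>M \<kappa> x)"
      using S sk by (simp cong: sets_pair_measure_cong)
    have meas: "(\<lambda>t. emeasure (\<kappa> x) (Pair t -` S)) \<in> borel_measurable borel"
      using K.measurable_emeasure_Pair[OF S'] by (simp cong: measurable_cong_sets)
    have "emeasure (return borel x \<Otimes>\<^sub>M \<kappa> x) S
        = (\<integral>\<^sup>+t. emeasure (\<kappa> x) (Pair t -` S) \<partial>return borel x)"
      by (rule K.emeasure_pair_measure_alt[OF S'])
    also have "\<dots> = emeasure (\<kappa> x) (Pair x -` S)"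
      by (rule nn_integral_return[OF _ meas]) simp
    finally show "emeasure (return borel x \<Otimes>\<^sub>M \<kappa> x) S = emeasure (\<kappa> x) {y. (x, y) \<in> S}"
      by (simp add: vimage_def)
  qed
  finally show ?thesis .
qed

lemma measurable_emeasure_section:
  assumes "disintegration \<pi> \<kappa>" and "S \<in> sets borel"
  shows "(\<lambda>x. emeasure (\<kappa> x) {y. (x, y) \<in> S}) \<in> borel_measurable borel"
proof (rule emeasure_measurable_subprob_algebra2)
  have "(SIGMA x:space borel. {y. (x, y) \<in> S}) = S" by auto
  then show "(SIGMA x:space borel. {y. (x, y) \<in> S}) \<in> sets (borel \<Otimes>\<^sub>M borel)"
    using assms(2) by (simp only: borel_prod)
  show "\<kappa> \<in> borel \<rightarrow>\<^sub>M subprob_algebra borel"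
    using assms(1) measurable_prob_algebraD unfolding disintegration_def by blast
qed

lemma emeasure_disintegration_eq_0_iff:
  assumes "disintegration \<pi> \<kappa>" and "S \<in> sets borel"
  shows "emeasure \<pi> S = 0 \<longleftrightarrow> (AE x in distr \<pi> borel fst. emeasure (\<kappa> x) {y. (x, y) \<in> S} = 0)"
  unfolding emeasure_disintegration[OF assms]
  by (rule nn_integral_0_iff_AE)
    (use measurable_emeasure_section[OF assms] in \<open>simp cong: measurable_cong_sets\<close>)

lemma sets_disintegration_kernel:
  assumes "disintegration \<pi> \<kappa>"
  shows "sets (\<kappa> x) = sets borel"
proof -
  have "\<kappa> x \<in> space (prob_algebra borel)"
    using assms unfolding disintegration_def by (auto intro: measurable_space)
  then show ?thesis by (auto simp: space_prob_algebra)
qed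

lemma emeasure_atom_times:
  assumes "disintegration \<pi> \<kappa>" and "V \<in> sets borel"
  shows "emeasure \<pi> ({x} \<times> V) = emeasure (\<kappa> x) V * emeasure (distr \<pi> borel fst) {x}"
proof -
  have "{x} \<times> V \<in> sets borel"
    using assms(2) by (metis borel_prod borel_singleton pair_measureI sets.empty_sets)
  then have "emeasure \<pi> ({x} \<times> V)
      = (\<integral>\<^sup>+t. emeasure (\<kappa> t) {y. (t, y) \<in> {x} \<times> V} \<partial>distr \<pi> borel fst)"
    by (rule emeasure_disintegration[OF assms(1)])
  also have "\<dots> = (\<integral>\<^sup>+t. emeasure (\<kappa> x) V * indicator {x} t \<partial>distr \<pi> borel fst)"
    by (rule nn_integral_cong) (auto simp: indicator_def)
  also have "\<dots> = emeasure (\<kappa> x) V * emeasure (distr \<pi> borel fst) {x}"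
    by (simp add: nn_integral_cmult_indicator)
  finally show ?thesis .
qed

section \<open>Topological support and right-isolated points\<close>

lemma closed_spt: "closed (spt M)"
proof -
  have "- spt M = \<Union>{U. open U \<and> emeasure M U = 0}"
    unfolding spt_def by auto
  then have "open (- spt M)" by auto
  then show ?thesis by (simp add: closed_def)
qed

text \<open>The complement of the support is a union of open null sets, which by the Lindelof property
  may be taken countable.\<close>

lemma emeasure_Compl_spt:
  fixes M :: "'a::second_countable_topology measure"
  assumes "sets M = sets borel"
  shows "emeasure M (- spt M) = 0"
proof -
  define \<F> where "\<F> = {U. open U \<and> emeasure M U = 0}"
  have Compl: "- spt M = \<Union>\<F>" unfolding \<F>_def spt_def by auto
  obtain \<F>' where \<F>': "\<F>' \<subseteq> \<F>" "countable \<F>'" "\<Union>\<F>' = \<Union>\<F>"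
    using Lindelof[of \<F>] unfolding \<F>_def by auto
  have "U \<in> null_sets M" if "U \<in> \<F>" for U
    using that assms unfolding \<F>_def null_sets_def by auto
  then have "(\<Union>U\<in>\<F>'. U) \<in> null_sets M"
    using \<F>'(1) by (intro null_sets_UN' \<F>'(2)) auto
  then show ?thesis
    unfolding Compl using \<F>'(3) by (simp add: null_sets_def)
qed

text \<open>The gaps to the right of distinct right-isolated points are disjoint, and each contains a
  rational.\<close>

lemma countable_right_isolated: "countable (right_isolated A)"
proof -
  have "\<exists>q\<in>\<rat>. x < q \<and> {x<..<q} \<inter> A = {}" if x: "x \<in> right_isolated A" for x
  proof -
    obtain \<epsilon> where "\<epsilon> > 0" "{x<..<x + \<epsilon>} \<inter> A = {}"
      using x unfolding right_isolated_def by blast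
    moreover obtain q where "q \<in> \<rat>" "x < q" "q < x + \<epsilon>"
      using Rats_dense_in_real[of x "x + \<epsilon>"] \<open>\<epsilon> > 0\<close> by auto
    moreover have "{x<..<q} \<subseteq> {x<..<x + \<epsilon>}" using \<open>q < x + \<epsilon>\<close> by auto
    ultimately show ?thesis by blast
  qed
  then obtain q where q: "q x \<in> \<rat>" "x < q x" "{x<..<q x} \<inter> A = {}"
    if "x \<in> right_isolated A" for x by metis
  have "inj_on q (right_isolated A)"
  proof (rule linorder_inj_onI)
    fix x x' assume "x < x'" and x: "x \<in> right_isolated A" and x': "x' \<in> right_isolated A"
    have "x' \<in> A" using x' unfolding right_isolated_def by simp
    then have "q x \<le> x'" using q(3)[OF x] \<open>x < x'\<close> by (meson disjoint_iff greaterThanLessThan_iff not_le)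
    then show "q x \<noteq> q x'" using q(2)[OF x'] by simp
  qed auto
  moreover have "countable (q ` right_isolated A)"
    by (rule countable_subset[OF _ countable_rat]) (use q(1) in auto)
  ultimately show ?thesis
    by (rule countable_image_inj_on[rotated])
qed

section \<open>The kernel of a martingale coupling charges both sides\<close>

lemma martingale_coupling_set_integral:
  assumes "\<pi> \<in> martingale_couplings \<mu> \<nu>"
    and "integrable \<mu> (\<lambda>x. x)" and "integrable \<nu> (\<lambda>y. y)"
    and "C \<in> sets borel"
  shows "integrable \<pi> (\<lambda>z. indicator C (fst z) * (snd z - fst z))"
    and "(\<integral>z. indicator C (fst z) * (snd z - fst z) \<partial>\<pi>) = 0"
proof -
  have sets: "sets \<pi> = sets borel" and prob: "prob_space \<pi>"
    and marg: "distr \<pi> borel fst = \<mu>" "distr \<pi> borel snd = \<nu>"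
    and mart: "AE z in \<pi>. real_cond_exp \<pi> (vimage_algebra (space \<pi>) fst borel) snd z = fst z"
    using assms(1) unfolding martingale_couplings_def by auto
  have space: "space \<pi> = UNIV" using sets_eq_imp_space_eq[OF sets] by simp
  have fst: "fst \<in> borel_measurable \<pi>" and snd: "snd \<in> borel_measurable \<pi>"
    by (simp_all add: measurable_cong_sets[OF sets refl] borel_measurable_continuous_onI
        continuous_on_fst continuous_on_snd)
  let ?F = "vimage_algebra (space \<pi>) (fst :: real \<times> real \<Rightarrow> real) borel"
  interpret prob_space \<pi> by fact
  have sub: "subalgebra \<pi> ?F"
    unfolding subalgebra_def
    by (auto simp: space sets_vimage_algebra2 intro!: sets.Int_space_eq2)
       (metis Int_UNIV_right fst measurable_sets space)
  have "finite_measure_subalgebra \<pi> ?F"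
    by (intro finite_measure_subalgebra.intro finite_measure_subalgebra_axioms.intro
        finite_measure_axioms sub)
  then interpret S: finite_measure_subalgebra \<pi> ?F .
  have "integrable (distr \<pi> borel fst) (\<lambda>x. x)" and "integrable (distr \<pi> borel snd) (\<lambda>x. x)"
    using assms(2,3) by (simp_all only: marg)
  then have X: "integrable \<pi> fst" and Y: "integrable \<pi> snd"
    using integrable_distr[OF fst] integrable_distr[OF snd] by blast+
  have CF: "fst -` C \<in> sets ?F"
    using in_vimage_algebra[OF assms(4), of fst "space \<pi>"] by (simp add: space)
  have C\<pi>: "fst -` C \<in> sets \<pi>"
    using CF sub unfolding subalgebra_def by auto
  have "(\<integral>z\<in>fst -` C. snd z \<partial>\<pi>) = (\<integral>z\<in>fst -` C. real_cond_exp \<pi> ?F snd z \<partial>\<pi>)"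
    by (rule S.real_cond_exp_intA[OF Y CF])
  also have "\<dots> = (\<integral>z\<in>fst -` C. fst z \<partial>\<pi>)"
    using C\<pi> mart by (intro set_lebesgue_integral_cong_AE) (auto simp: fst)
  finally have eq: "(\<integral>z\<in>fst -` C. snd z \<partial>\<pi>) = (\<integral>z\<in>fst -` C. fst z \<partial>\<pi>)" .
  have iX: "integrable \<pi> (\<lambda>z. indicator (fst -` C) z * fst z)"
    using integrable_mult_indicator[OF C\<pi> X] by simp
  have iY: "integrable \<pi> (\<lambda>z. indicator (fst -` C) z * snd z)"
    using integrable_mult_indicator[OF C\<pi> Y] by simp
  have split: "indicator C (fst z) * (snd z - fst z)
      = indicator (fst -` C) z * snd z - indicator (fst -` C) z * fst z" for z :: "real \<times> real"
    by (simp add: indicator_def)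
  show "integrable \<pi> (\<lambda>z. indicator C (fst z) * (snd z - fst z))"
    unfolding split using iX iY by simp
  show "(\<integral>z. indicator C (fst z) * (snd z - fst z) \<partial>\<pi>) = 0"
    unfolding split using iX iY eq by (simp add: set_lebesgue_integral_def)
qed

text \<open>Let \<open>C\<close> be the set of \<open>x\<close> at which the premise holds. On \<open>C \<times> UNIV\<close> the displacement
  \<open>s * (y - x)\<close> is almost everywhere nonnegative, and it integrates to \<open>0\<close> by the martingale
  property, so it vanishes almost everywhere. The real parameter \<open>s\<close> stands for a sign and serves
  both orientations at once.\<close>

lemma martingale_kernel_two_sided:
  fixes s :: real
  assumes "\<pi> \<in> martingale_couplings \<mu> \<nu>"
    and "integrable \<mu> (\<lambda>x. x)" and "integrable \<nu> (\<lambda>y. y)"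
    and dis: "disintegration \<pi> \<kappa>"
  shows "AE x in \<mu>. emeasure (\<kappa> x) {y. s * (y - x) < 0} = 0 \<longrightarrow>
    emeasure (\<kappa> x) {y. 0 < s * (y - x)} = 0"
proof -
  have sets: "sets \<pi> = sets borel" and marg: "distr \<pi> borel fst = \<mu>"
    using assms(1) unfolding martingale_couplings_def by auto
  have space: "space \<pi> = UNIV" using sets_eq_imp_space_eq[OF sets] by simp
  define C where "C = {x. emeasure (\<kappa> x) {y. s * (y - x) < 0} = 0}"
  let ?N = "{z :: real \<times> real. s * (snd z - fst z) < 0}"
  have N: "?N \<in> sets borel"
    by (intro borel_open open_Collect_less continuous_intros)
  have C[measurable]: "C \<in> sets borel"
    using measurable_emeasure_section[OF dis N] unfolding C_def by simp
  have fst_snd[measurable]: "(fst :: real \<times> real \<Rightarrow> real) \<in> borel_measurable borel"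
    "(snd :: real \<times> real \<Rightarrow> real) \<in> borel_measurable borel"
    by (simp_all add: borel_measurable_continuous_onI continuous_on_fst continuous_on_snd)
  have neg: "{z :: real \<times> real. fst z \<in> C \<and> s * (snd z - fst z) < 0} \<in> sets borel"
    and pos: "{z :: real \<times> real. fst z \<in> C \<and> 0 < s * (snd z - fst z)} \<in> sets borel"
    by measurable
  let ?h = "\<lambda>z. s * (indicator C (fst z) * (snd z - fst z))"
  have int: "integrable \<pi> ?h" and zero: "(\<integral>z. ?h z \<partial>\<pi>) = 0"
    using martingale_coupling_set_integral[OF assms(1-3) C] by simp_all
  have "emeasure \<pi> {z. fst z \<in> C \<and> s * (snd z - fst z) < 0} = 0"
    unfolding emeasure_disintegration_eq_0_iff[OF dis neg]
  proof (rule AE_I2)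
    fix x
    have "emeasure (\<kappa> x) {y. s * (y - x) < 0} = 0" if "x \<in> C"
      using that unfolding C_def by simp
    then show "emeasure (\<kappa> x) {y. (x, y) \<in> {z. fst z \<in> C \<and> s * (snd z - fst z) < 0}} = 0"
      by (cases "x \<in> C") simp_all
  qed
  then have "AE z in \<pi>. \<not> (fst z \<in> C \<and> s * (snd z - fst z) < 0)"
    using neg sets space by (subst AE_iff_null) (auto simp: null_sets_def)
  then have "AE z in \<pi>. 0 \<le> ?h z"
    by eventually_elim (auto simp: indicator_def)
  then have "AE z in \<pi>. ?h z = 0"
    using integral_nonneg_eq_0_iff_AE[OF int] zero by simp
  then have "AE z in \<pi>. \<not> (fst z \<in> C \<and> 0 < s * (snd z - fst z))"
    by eventually_elim (auto simp: indicator_def)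
  then have "emeasure \<pi> {z. fst z \<in> C \<and> 0 < s * (snd z - fst z)} = 0"
    using pos sets space by (subst (asm) AE_iff_null) (auto simp: null_sets_def)
  then show ?thesis
    unfolding emeasure_disintegration_eq_0_iff[OF dis pos] marg
    by eventually_elim (auto simp: C_def)
qed

text \<open>This provides the second point on a vertical line that left monotonicity asks for. Since
  \<open>W\<close> has positive measure, some typical \<open>a\<close> has a section of \<open>W\<close> charged by \<open>\<kappa> a\<close>; typical means
  that \<open>\<kappa> a\<close> is concentrated on the section of \<open>\<Gamma>\<close> and charges both sides of \<open>a\<close> if it charges
  one.\<close>

lemma martingale_opposite_point:
  fixes s :: real
  assumes \<pi>: "\<pi> \<in> martingale_couplings \<mu> \<nu>"
    and "integrable \<mu> (\<lambda>x. x)" and "integrable \<nu> (\<lambda>y. y)"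
    and dis: "disintegration \<pi> \<kappa>"
    and \<Gamma>: "\<Gamma> \<in> sets borel" "emeasure \<pi> \<Gamma> = 1"
    and W: "W \<in> sets borel" "0 < emeasure \<pi> W"
    and side: "\<And>a b. (a, b) \<in> W \<Longrightarrow> 0 < s * (b - a)"
  obtains a b b' where "(a, b) \<in> W" "(a, b) \<in> \<Gamma>" "(a, b') \<in> \<Gamma>" "s * (b' - a) < 0"
proof -
  have sets: "sets \<pi> = sets borel" and prob: "prob_space \<pi>" and marg: "distr \<pi> borel fst = \<mu>"
    using \<pi> unfolding martingale_couplings_def by auto
  have space: "space \<pi> = UNIV" using sets_eq_imp_space_eq[OF sets] by simp
  interpret prob_space \<pi> by fact
  have "emeasure \<pi> (- \<Gamma>) = 0"
    using emeasure_compl[of \<Gamma> \<pi>] \<Gamma> sets space emeasure_space_1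
    by (simp add: Compl_eq_Diff_UNIV)
  then have null_AE: "AE x in \<mu>. emeasure (\<kappa> x) {y. (x, y) \<in> - \<Gamma>} = 0"
    using emeasure_disintegration_eq_0_iff[OF dis, of "- \<Gamma>"] \<Gamma>(1) unfolding marg by simp
  have two_sided_AE: "AE x in \<mu>. emeasure (\<kappa> x) {y. s * (y - x) < 0} = 0 \<longrightarrow>
      emeasure (\<kappa> x) {y. 0 < s * (y - x)} = 0"
    by (rule martingale_kernel_two_sided[OF assms(1-4)])
  have W_AE: "\<not> (AE x in \<mu>. emeasure (\<kappa> x) {y. (x, y) \<in> W} = 0)"
    using emeasure_disintegration_eq_0_iff[OF dis W(1)] W(2) unfolding marg by (metis less_irrefl)
  obtain a where
    null: "emeasure (\<kappa> a) {y. (a, y) \<in> - \<Gamma>} = 0" and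
    two_sided: "emeasure (\<kappa> a) {y. s * (y - a) < 0} = 0 \<longrightarrow>
      emeasure (\<kappa> a) {y. 0 < s * (y - a)} = 0" and
    Wa: "emeasure (\<kappa> a) {y. (a, y) \<in> W} \<noteq> 0"
  proof (rule ccontr)
    assume none: "\<not> thesis"
    have "AE x in \<mu>. emeasure (\<kappa> x) {y. (x, y) \<in> W} = 0"
      using null_AE two_sided_AE by eventually_elim (use none that in blast)
    then show False using W_AE by simp
  qed
  have section_sets: "{y. (a, y) \<in> S} \<in> sets (\<kappa> a)" if "S \<in> sets borel" for S :: "(real \<times> real) set"
  proof -
    have "Pair a -` S \<in> sets borel"
      using sets_Pair1[of S borel borel a] that by (simp only: borel_prod)
    then show ?thesis using sets_disintegration_kernel[OF dis] by (simp add: vimage_def)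
  qed
  have meets: "\<exists>y. (a, y) \<in> \<Gamma> \<and> y \<in> V" if "emeasure (\<kappa> a) V \<noteq> 0" for V
  proof (rule ccontr)
    assume "\<not> ?thesis"
    then have "V \<subseteq> {y. (a, y) \<in> - \<Gamma>}" by auto
    then have "emeasure (\<kappa> a) V \<le> emeasure (\<kappa> a) {y. (a, y) \<in> - \<Gamma>}"
      using \<Gamma>(1) by (intro emeasure_mono section_sets) auto
    then show False using null that by simp
  qed
  have "emeasure (\<kappa> a) {y. (a, y) \<in> W} \<le> emeasure (\<kappa> a) {y. 0 < s * (y - a)}"
  proof (rule emeasure_mono)
    have "{y. 0 < s * (y - a)} \<in> sets borel"
      by (intro borel_open open_Collect_less continuous_intros)
    then show "{y. 0 < s * (y - a)} \<in> sets (\<kappa> a)"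
      using sets_disintegration_kernel[OF dis] by simp
  qed (use side in auto)
  then have "emeasure (\<kappa> a) {y. s * (y - a) < 0} \<noteq> 0"
    using Wa two_sided by auto
  then show thesis
    using meets[OF Wa] meets[of "{y. s * (y - a) < 0}"] that by auto
qed

section \<open>The reduced support\<close>

lemma reduced_spt_subset_spt:
  assumes sets: "sets \<pi> = sets borel" and dis: "disintegration \<pi> \<kappa>"
  shows "reduced_spt \<pi> \<kappa> \<subseteq> spt \<pi>"
proof -
  have "(x, y) \<in> spt \<pi>"
    if atom: "0 < emeasure (distr \<pi> borel fst) {x}" and y: "y \<in> spt (\<kappa> x)" for x y
    unfolding spt_def
  proof safe
    fix U :: "(real \<times> real) set" assume "open U" "(x, y) \<in> U"
    then obtain V1 V2 where V: "open V1" "open V2" "x \<in> V1" "y \<in> V2" "V1 \<times> V2 \<subseteq> U"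
      by (metis open_prod_elim mem_Sigma_iff)
    have "0 < emeasure (\<kappa> x) V2 * emeasure (distr \<pi> borel fst) {x}"
      using y V(2,4) atom unfolding spt_def by (auto simp: ennreal_zero_less_mult_iff)
    also have "\<dots> = emeasure \<pi> ({x} \<times> V2)"
      using emeasure_atom_times[OF dis, of V2 x] V(2) by simp
    also have "\<dots> \<le> emeasure \<pi> U"
      using V \<open>open U\<close> sets by (intro emeasure_mono) auto
    finally show "0 < emeasure \<pi> U" .
  qed
  then show ?thesis unfolding reduced_spt_def by auto
qed

lemma sets_reduced_spt:
  assumes "prob_space \<pi>" and sets: "sets \<pi> = sets borel"
  shows "reduced_spt \<pi> \<kappa> \<in> sets borel"
proof -
  interpret prob_space \<pi> by fact
  have "fst \<in> borel_measurable \<pi>"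
    by (simp add: measurable_cong_sets[OF sets refl] borel_measurable_continuous_onI
        continuous_on_fst)
  then interpret D: prob_space "distr \<pi> borel fst"
    by (rule prob_space_distr)
  have atoms: "countable {x. 0 < emeasure (distr \<pi> borel fst) {x}}"
    using D.countable_support by (simp add: D.emeasure_eq_measure zero_less_measure_iff)
  have cyl: "right_isolated (no_crossing \<pi>) \<times> UNIV
      = (\<Union>x\<in>right_isolated (no_crossing \<pi>). {x} \<times> (UNIV :: real set))" by auto
  have "right_isolated (no_crossing \<pi>) \<times> (UNIV :: real set) \<in> sets borel"
    unfolding cyl by (intro sets.countable_UN' countable_right_isolated)
      (auto intro!: borel_closed closed_Times)
  moreover have "(\<Union>x\<in>{x. 0 < emeasure (distr \<pi> borel fst) {x}}. {x} \<times> spt (\<kappa> x)) \<in> sets borel"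
    by (intro sets.countable_UN' atoms) (auto intro!: borel_closed closed_Times closed_spt)
  ultimately show ?thesis
    unfolding reduced_spt_def by (intro sets.Un sets.Diff) (auto simp: closed_spt)
qed

lemma emeasure_reduced_spt:
  assumes "prob_space \<pi>" and sets: "sets \<pi> = sets borel" and dis: "disintegration \<pi> \<kappa>"
  shows "emeasure \<pi> (reduced_spt \<pi> \<kappa>) = 1"
proof -
  interpret prob_space \<pi> by fact
  have space: "space \<pi> = UNIV" using sets_eq_imp_space_eq[OF sets] by simp
  have "fst \<in> borel_measurable \<pi>"
    by (simp add: measurable_cong_sets[OF sets refl] borel_measurable_continuous_onI
        continuous_on_fst)
  then interpret D: prob_space "distr \<pi> borel fst"
    by (rule prob_space_distr)
  let ?A = "right_isolated (no_crossing \<pi>)"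
  let ?at = "{x. 0 < emeasure (distr \<pi> borel fst) {x}}"
  have atoms: "countable ?at"
    using D.countable_support by (simp add: D.emeasure_eq_measure zero_less_measure_iff)
  have "- spt \<pi> \<in> null_sets \<pi>"
    using emeasure_Compl_spt[OF sets] sets
    by (auto simp: null_sets_def intro!: borel_open closed_spt)
  moreover have "(\<Union>x\<in>?A - ?at. {x} \<times> UNIV) \<in> null_sets \<pi>"
  proof (intro null_sets_UN' countable_Diff countable_right_isolated null_setsI)
    fix x assume "x \<in> ?A - ?at"
    then show "emeasure \<pi> ({x} \<times> UNIV) = 0"
      using emeasure_atom_times[OF dis, of UNIV x] by simp
    show "{x} \<times> UNIV \<in> sets \<pi>" using sets by (auto intro!: borel_closed closed_Times)
  qed
  moreover have "(\<Union>x\<in>?at. {x} \<times> - spt (\<kappa> x)) \<in> null_sets \<pi>"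
  proof (intro null_sets_UN' atoms null_setsI)
    fix x
    have V: "- spt (\<kappa> x) \<in> sets borel" by (intro borel_open open_Compl closed_spt)
    show "emeasure \<pi> ({x} \<times> - spt (\<kappa> x)) = 0"
      using emeasure_atom_times[OF dis V, of x]
        emeasure_Compl_spt[OF sets_disintegration_kernel[OF dis], of x] by simp
    show "{x} \<times> - spt (\<kappa> x) \<in> sets \<pi>"
      using V unfolding sets by (metis borel_prod borel_singleton pair_measureI sets.empty_sets)
  qed
  ultimately have "- spt \<pi> \<union> ((\<Union>x\<in>?A - ?at. {x} \<times> UNIV) \<union> (\<Union>x\<in>?at. {x} \<times> - spt (\<kappa> x)))
      \<in> null_sets \<pi>" (is "?N \<in> _")
    by (intro null_sets.Un) auto
  moreover have "{z \<in> space \<pi>. z \<notin> reduced_spt \<pi> \<kappa>} \<subseteq> ?N"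
    unfolding reduced_spt_def by auto
  ultimately have "AE z in \<pi>. z \<in> reduced_spt \<pi> \<kappa>"
    by (rule AE_I')
  then show ?thesis
    using sets_reduced_spt[OF assms(1,2)] sets by (intro emeasure_eq_1_AE) auto
qed

section \<open>Left monotonicity passes to the reduced support\<close>

lemma left_monotone_on_reduced_spt:
  assumes \<pi>: "\<pi> \<in> martingale_couplings \<mu> \<nu>"
    and "integrable \<mu> (\<lambda>x. x)" and "integrable \<nu> (\<lambda>y. y)"
    and dis: "disintegration \<pi> \<kappa>"
    and "left_monotone \<pi>"
  shows "left_monotone_on (reduced_spt \<pi> \<kappa>)"
proof -
  have sets: "sets \<pi> = sets borel" and prob: "prob_space \<pi>"
    using \<pi> unfolding martingale_couplings_def by auto
  interpret prob_space \<pi> by fact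
  obtain \<Gamma> where \<Gamma>: "\<Gamma> \<in> sets borel" "emeasure \<pi> \<Gamma> = 1" and mono: "left_monotone_on \<Gamma>"
    using assms(5) unfolding left_monotone_def by auto
  note opposite = martingale_opposite_point[OF assms(1-4) \<Gamma>]
  have no_cross: False if "(a, b) \<in> \<Gamma>" "(a, b') \<in> \<Gamma>" "(e, f) \<in> \<Gamma>" "a < e" "b < f" "f < b'"
    for a b b' e f
  proof -
    have "b < b'" using that by simp
    then have "f \<notin> {b<..<b'}"
      using mono that unfolding left_monotone_on_def by blast
    then show False using that by simp
  qed
  have False if ym: "(x, ym) \<in> reduced_spt \<pi> \<kappa>" and yp: "(x, yp) \<in> reduced_spt \<pi> \<kappa>"
    and y': "(x', y') \<in> reduced_spt \<pi> \<kappa>" and "x < x'" "ym < y'" "y' < yp" for x ym yp x' y'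
  proof -
    have positive: "0 < emeasure \<pi> U" if "open U" "z \<in> U" "z \<in> reduced_spt \<pi> \<kappa>" for U z
      using that reduced_spt_subset_spt[OF sets dis] unfolding spt_def by auto
    have "0 < emeasure \<pi> ({x<..} \<times> {ym<..<yp})"
      using that by (intro positive[OF _ _ y'] open_Times) auto
    moreover have "emeasure \<pi> ({x<..} \<times> {ym<..<yp}) = 0"
      if "({x<..} \<times> {ym<..<yp}) \<inter> \<Gamma> = {}"
    proof -
      have "AE z in \<pi>. z \<in> \<Gamma>"
        using \<Gamma> sets by (subst AE_in_set_eq_1) (auto simp: emeasure_eq_measure)
      then have "AE z in \<pi>. z \<notin> {x<..} \<times> {ym<..<yp}"
        by eventually_elim (use that in blast)
      moreover have "{x<..} \<times> {ym<..<yp} \<in> sets \<pi>"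
        unfolding sets by (intro borel_open open_Times) auto
      ultimately show ?thesis by (simp add: AE_iff_null_sets[symmetric] null_setsD1)
    qed
    ultimately obtain e f where ef: "(e, f) \<in> \<Gamma>" "x < e" "ym < f" "f < yp"
      by fastforce
    consider "f < x" | "x < f" | "f = x" by linarith
    then show False
    proof cases
      assume "f < x"
      \<comment> \<open>Abscissae \<open>a > f\<close> put the partner \<open>b' > a\<close> above \<open>f\<close>, while \<open>b < f\<close>.\<close>
      let ?W = "{f<..<e} \<times> {..<f}"
      have "open ?W" by (intro open_Times) auto
      moreover from this have "0 < emeasure \<pi> ?W"
        using \<open>f < x\<close> ef by (intro positive[OF _ _ ym]) auto
      ultimately obtain a b b' where "(a, b) \<in> ?W" "(a, b) \<in> \<Gamma>" "(a, b') \<in> \<Gamma>" "-1 * (b' - a) < 0"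
        by (elim opposite[where W = ?W and s = "-1", OF borel_open]) auto
      then show False using no_cross[of a b b' e f] ef by auto
    next
      assume "x < f"
      let ?W = "{..<min e f} \<times> {f<..}"
      have "open ?W" by (intro open_Times) auto
      moreover from this have "0 < emeasure \<pi> ?W"
        using \<open>x < f\<close> ef by (intro positive[OF _ _ yp]) auto
      ultimately obtain a b b' where "(a, b) \<in> ?W" "(a, b) \<in> \<Gamma>" "(a, b') \<in> \<Gamma>" "1 * (b' - a) < 0"
        by (elim opposite[where W = ?W and s = 1, OF borel_open]) auto
      then show False using no_cross[of a b' b e f] ef by auto
    next
      assume "f = x"
      \<comment> \<open>The triple is not yet contradictory here; it first forces \<open>x\<close> to be one of the points
        at which the reduced support is read off from \<open>\<kappa> x\<close>.\<close>
      have "x \<in> no_crossing \<pi>"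
      proof (rule ccontr)
        assume "x \<notin> no_crossing \<pi>"
        then have "0 < emeasure \<pi> ({..<x} \<times> {x<..})"
          unfolding no_crossing_def by (simp add: zero_less_iff_neq_zero)
        moreover have "open ({..<x} \<times> {x<..})" by (intro open_Times) auto
        ultimately obtain a b b' where
          "(a, b) \<in> {..<x} \<times> {x<..}" "(a, b) \<in> \<Gamma>" "(a, b') \<in> \<Gamma>" "1 * (b' - a) < 0"
          by (elim opposite[where W = "{..<x} \<times> {x<..}" and s = 1, OF borel_open]) auto
        then show False using no_cross[of a b' b e f] ef \<open>f = x\<close> by auto
      qed
      moreover have "t \<notin> no_crossing \<pi>" if "x < t" "t < yp" for t
      proof -
        have "0 < emeasure \<pi> ({..<t} \<times> {t<..})"
          using that by (intro positive[OF _ _ yp] open_Times) auto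
        then show ?thesis unfolding no_crossing_def by simp
      qed
      ultimately have "x \<in> right_isolated (no_crossing \<pi>)"
        unfolding right_isolated_def using ef \<open>f = x\<close> by (auto intro!: exI[of _ "yp - x"])
      then have atom: "0 < emeasure (distr \<pi> borel fst) {x}" and "ym \<in> spt (\<kappa> x)"
        using ym unfolding reduced_spt_def by auto
      then have "0 < emeasure (\<kappa> x) {..<x}"
        using ef \<open>f = x\<close> unfolding spt_def by auto
      then have "0 < emeasure \<pi> ({x} \<times> {..<x})"
        using atom emeasure_atom_times[OF dis, of "{..<x}" x]
        by (auto simp: ennreal_zero_less_mult_iff)
      moreover have "{x} \<times> {..<x} \<in> sets borel"
        by (metis borel_prod borel_singleton lessThan_borel pair_measureI sets.empty_sets)
      ultimately obtain a b b' where
        "(a, b) \<in> {x} \<times> {..<x}" "(a, b) \<in> \<Gamma>" "(a, b') \<in> \<Gamma>" "-1 * (b' - a) < 0"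
        by (elim opposite[where W = "{x} \<times> {..<x}" and s = "-1", rotated]) auto
      then show False using no_cross[of a b b' e f] ef \<open>f = x\<close> by auto
    qed
  qed
  then show ?thesis unfolding left_monotone_on_def by auto
qed

theorem proposition2p14:
  fixes \<mu> \<nu> :: "real measure" and \<pi> :: "(real \<times> real) measure" and \<kappa> :: "real \<Rightarrow> real measure"
  assumes "real_distribution \<mu>" and "integrable \<mu> (\<lambda>x. x)"
    and "real_distribution \<nu>" and "integrable \<nu> (\<lambda>y. y)"
    and "\<pi> \<in> martingale_couplings \<mu> \<nu>"
    and "disintegration \<pi> \<kappa>"
  shows "left_monotone \<pi> \<longleftrightarrow>
    (\<forall>x ym yp x' y'. (x, yp) \<in> reduced_spt \<pi> \<kappa> \<and> (x, ym) \<in> reduced_spt \<pi> \<kappa> \<and>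
       (x', y') \<in> reduced_spt \<pi> \<kappa> \<and> x < x' \<and> ym < yp \<longrightarrow> y' \<notin> {ym<..<yp})"
proof -
  have sets: "sets \<pi> = sets borel" and prob: "prob_space \<pi>"
    using assms(5) unfolding martingale_couplings_def by auto
  have "left_monotone \<pi> \<longleftrightarrow> left_monotone_on (reduced_spt \<pi> \<kappa>)"
  proof
    assume "left_monotone \<pi>"
    then show "left_monotone_on (reduced_spt \<pi> \<kappa>)"
      by (rule left_monotone_on_reduced_spt[OF assms(5,2,4,6)])
  next
    assume "left_monotone_on (reduced_spt \<pi> \<kappa>)"
    then show "left_monotone \<pi>"
      unfolding left_monotone_def
      using sets_reduced_spt[OF prob sets] emeasure_reduced_spt[OF prob sets assms(6)] by blast
  qed
  then show ?thesis unfolding left_monotone_on_def by meson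
qed

end
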